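(* Let $m\ge1$ and let $\Omega=\{(\lambda,u)\in\mathbb R\oplus\mathbb R^m:\lambda>\|u\|\}$ be the Lorentz cone. For $x=(\lambda,u)$ and $y=(\mu,v)$ in $\Omega$ set $$a:=\lambda^2-\|u\|^2,\qquad b:=\mu^2-\|v\|^2,\qquad \gamma:=\sqrt{\frac{\lambda\mu+\langle u,v\rangle+\sqrt{ab}}{2}}.$$ Then the spectral geometric mean of $x$ and $y$ is $$x\mathbin{\natural}y=\left(\gamma,\ \frac{(ab)^{1/4}(\mu u+\lambda v)+\gamma(\sqrt b\,u+\sqrt a\,v)}{\lambda\sqrt b+\mu\sqrt a+2\gamma(ab)^{1/4}}\right).$$
   Context: $V=\mathbb R\oplus\mathbb R^m$ is the Euclidean Jordan algebra (spin factor) with product $(\lambda,u)\circ(\mu,v)=(\lambda\mu+\langle u,v\rangle,\ \lambda v+\mu u)$ and unit $e=(1,0)$, where $\langle\cdot,\cdot\rangle$ is the standard inner product of $\mathbb R^m$; its symmetric cone is the Lorentz cone $\Omega$. With $L(x)y=x\circ y$, the quadratic representation is $P(x)=2L(x)^2-L(x\circ x)$. For $x=(\lambda,u)\in\Omega$, the inverse is $x^{-1}=\frac{1}{\lambda^2-\|u\|^2}(\lambda,-u)$, $x^{1/2}$ is the unique element of $\Omega$ with $x^{1/2}\circ x^{1/2}=x$, and $x^{-1/2}=(x^{1/2})^{-1}$. For $p,q\in\Omega$, the metric geometric mean is $p\mathbin{\#}q=P(p^{1/2})\bigl(P(p^{-1/2})q\bigr)^{1/2}$ and the spectral geometric mean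 is $p\mathbin{\natural}q=P\bigl((p^{-1}\mathbin{\#}q)^{1/2}\bigr)p$. *)

theory Defs
  imports "HOL-Analysis.Analysis"
begin

text \<open>
  The spin factor on \<open>V = real \<times> real ^ 'm\<close>. Since types are nonempty, the dimension
  \<open>CARD('m)\<close> is an arbitrary integer \<open>\<ge> 1\<close>.
\<close>

type_synonym 'm spin = "real \<times> (real, 'm) vec"

definition jordan_prod :: "('m::finite) spin \<Rightarrow> 'm spin \<Rightarrow> 'm spin"  (infixl \<open>\<bullet>\<^sub>J\<close> 70) where
  "x \<bullet>\<^sub>J y = (fst x * fst y + inner (snd x) (snd y), fst x *\<^sub>R snd y + fst y *\<^sub>R snd x)"

definition jordan_L :: "('m::finite) spin \<Rightarrow> 'm spin \<Rightarrow> 'm spin" where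
  "jordan_L x y = x \<bullet>\<^sub>J y"

definition quad_rep :: "('m::finite) spin \<Rightarrow> 'm spin \<Rightarrow> 'm spin" where
  "quad_rep x = (\<lambda>y. 2 *\<^sub>R (jordan_L x \<circ> jordan_L x) y - jordan_L (x \<bullet>\<^sub>J x) y)"

definition lorentz_cone :: "('m::finite) spin set" where
  "lorentz_cone = {(l, u). l > norm u}"

text \<open>The operations below are meaningful for arguments in the cone only.\<close>

definition jordan_inv :: "('m::finite) spin \<Rightarrow> 'm spin" where
  "jordan_inv x = (1 / ((fst x)\<^sup>2 - (norm (snd x))\<^sup>2)) *\<^sub>R (fst x, - snd x)"

definition jordan_sqrt :: "('m::finite) spin \<Rightarrow> 'm spin" where
  "jordan_sqrt x = (THE y. y \<in> lorentz_cone \<and> y \<bullet>\<^sub>J y = x)"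

definition metric_gmean :: "('m::finite) spin \<Rightarrow> 'm spin \<Rightarrow> 'm spin"  (infixl \<open>\<sharp>\<close> 70) where
  "p \<sharp> q = quad_rep (jordan_sqrt p) (jordan_sqrt (quad_rep (jordan_inv (jordan_sqrt p)) q))"

definition spectral_gmean :: "('m::finite) spin \<Rightarrow> 'm spin \<Rightarrow> 'm spin"  (infixl \<open>\<natural>\<close> 70) where
  "p \<natural> q = quad_rep (jordan_sqrt (jordan_inv p \<sharp> q)) p"

end

theory Submission
  imports Defs
begin

text \<open>
  A spin factor has rank two, so every element is a root of the quadratic polynomial
  \<open>t\<^sup>2 - 2 (fst x) t + jdet x\<close>. This makes both ingredients of the means explicit. The
  square root of \<open>x\<close> in the cone is a multiple of \<open>x + sqrt (jdet x) e\<close>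
  (\<open>jordan_sqrt_eq\<close>), and the quadratic representation is
  \<open>P x y = 2 (x \<bullet> y) x - (jdet x) (jconj y)\<close> (\<open>quad_rep_eq\<close>), with the Euclidean inner product
  of \<open>V\<close> and the conjugation \<open>jconj (l, u) = (l, - u)\<close>.

  The metric mean then needs little further computation. With \<open>s\<close> the square root of \<open>p\<close> and
  \<open>h = P (s\<^sup>-\<^sup>1) q\<close>, the square root of \<open>h\<close> is a combination of \<open>h\<close> and \<open>e\<close>, and the linear
  map \<open>P s\<close> sends \<open>h\<close> to \<open>q\<close> and \<open>e\<close> to \<open>p\<close>. Hence \<open>p \<sharp> q\<close> is an explicit combination of
  \<open>q\<close> and \<open>p\<close> (\<open>metric_gmean_eq\<close>). For \<open>g = x\<^sup>-\<^sup>1 \<sharp> y\<close> and \<open>\<delta> = sqrt (jdet g)\<close>, that is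
  \<open>\<delta>\<^sup>4 = b / a\<close>, this gives \<open>g = (y + \<delta>\<^sup>2 (jconj x)) / (2 \<gamma>)\<close> and \<open>g \<bullet> x = \<gamma>\<close>. Applying the
  quadratic representation of the square root of \<open>g\<close> to \<open>x\<close> yields
  \<open>((\<gamma> + \<delta> l) / (fst g + \<delta>)) (g + \<delta> e) - \<delta> (jconj x)\<close>, whose components are the asserted ones
  once the fraction in the second component is expanded by \<open>sqrt a\<close>.
\<close>

section \<open>Determinant, conjugation and the quadratic representation\<close>

definition jdet :: "('m::finite) spin \<Rightarrow> real" where
  "jdet x = (fst x)\<^sup>2 - inner (snd x) (snd x)"

definition jconj :: "('m::finite) spin \<Rightarrow> 'm spin" where
  "jconj x = (fst x, - snd x)"

definition junit :: "('m::finite) spin" where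
  "junit = (1, 0)"

lemma jordan_inv_eq: "jordan_inv x = (1 / jdet x) *\<^sub>R jconj x"
  by (simp add: jordan_inv_def jdet_def jconj_def power2_norm_eq_inner)

lemma lorentz_cone_iff: "x \<in> lorentz_cone \<longleftrightarrow> fst x > 0 \<and> jdet x > 0"
proof -
  obtain l u where x: "x = (l, u)" by (cases x)
  have "norm u < l \<longleftrightarrow> l > 0 \<and> (norm u)\<^sup>2 < l\<^sup>2"
    by (smt (verit) norm_ge_zero power_less_imp_less_base power_strict_mono zero_less_numeral)
  then show ?thesis
    by (simp add: x lorentz_cone_def jdet_def power2_norm_eq_inner)
qed

lemma jdet_scaleR: "jdet (c *\<^sub>R x) = c\<^sup>2 * jdet x"
  by (simp add: jdet_def power2_eq_square algebra_simps)

lemma jdet_jconj [simp]: "jdet (jconj x) = jdet x"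
  by (simp add: jdet_def jconj_def)

lemma jdet_add_junit: "jdet (x + c *\<^sub>R junit) = jdet x + 2 * c * fst x + c\<^sup>2"
  by (simp add: jdet_def junit_def power2_eq_square algebra_simps)

lemma jdet_jordan_inv: "jdet (jordan_inv x) = 1 / jdet x"
  by (simp add: jordan_inv_eq jdet_scaleR power2_eq_square)

lemma jordan_inv_in_cone: "x \<in> lorentz_cone \<Longrightarrow> jordan_inv x \<in> lorentz_cone"
  by (simp add: lorentz_cone_iff jdet_jordan_inv) (simp add: jordan_inv_eq jconj_def)

text \<open>The Cayley--Hamilton identity of the rank-two algebra.\<close>

lemma jordan_square_eq: "x \<bullet>\<^sub>J x = (2 * fst x) *\<^sub>R x - jdet x *\<^sub>R junit"
  by (cases x)
    (simp add: jordan_prod_def jdet_def junit_def power2_eq_square scaleR_2 flip: scaleR_scaleR)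

lemma jdet_square: "jdet (x \<bullet>\<^sub>J x) = (jdet x)\<^sup>2"
proof -
  have "x \<bullet>\<^sub>J x = (2 * fst x) *\<^sub>R x + (- jdet x) *\<^sub>R junit"
    by (simp add: jordan_square_eq)
  then have "jdet (x \<bullet>\<^sub>J x) =
      (2 * fst x)\<^sup>2 * jdet x + 2 * (- jdet x) * ((2 * fst x) * fst x) + (- jdet x)\<^sup>2"
    by (simp only: jdet_add_junit jdet_scaleR fst_scaleR real_scaleR_def)
  then show ?thesis by (simp add: power2_eq_square)
qed

lemma quad_rep_eq: "quad_rep x y = (2 * inner x y) *\<^sub>R x - jdet x *\<^sub>R jconj y"
proof (rule prod_eqI)
  have "inner (fst x *\<^sub>R snd x + fst x *\<^sub>R snd x) (snd y) = 2 * fst x * inner (snd x) (snd y)"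
    by (simp only: inner_add_left inner_scaleR_left)
  then show "fst (quad_rep x y) = fst ((2 * inner x y) *\<^sub>R x - jdet x *\<^sub>R jconj y)"
    by (simp only: quad_rep_def jordan_L_def jordan_prod_def jdet_def jconj_def inner_prod_def
        fst_diff fst_scaleR snd_conv fst_conv o_apply inner_add_right inner_scaleR_right)
      (simp add: power2_eq_square algebra_simps)
  show "snd (quad_rep x y) = snd ((2 * inner x y) *\<^sub>R x - jdet x *\<^sub>R jconj y)"
    by (simp add: quad_rep_def jordan_L_def jordan_prod_def jdet_def jconj_def inner_prod_def
        power2_eq_square vec_eq_iff algebra_simps)
qed

lemma quad_rep_add: "quad_rep x (y + z) = quad_rep x y + quad_rep x z"
  by (simp add: quad_rep_eq jconj_def inner_simps algebra_simps)

lemma quad_rep_scaleR: "quad_rep x (c *\<^sub>R y) = c *\<^sub>R quad_rep x y"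
proof -
  have "jconj (c *\<^sub>R y) = c *\<^sub>R jconj y" by (simp add: jconj_def)
  then show ?thesis by (simp add: quad_rep_eq scaleR_diff_right mult.commute mult.left_commute)
qed

lemma quad_rep_junit: "quad_rep x junit = x \<bullet>\<^sub>J x"
  by (cases x) (simp add: quad_rep_eq jordan_square_eq jconj_def junit_def)

lemma inner_jconj_jconj: "inner (jconj x) (jconj y) = inner x y"
  by (simp add: jconj_def inner_prod_def)

lemma inner_jconj_self: "inner x (jconj x) = jdet x"
  by (simp add: jconj_def inner_prod_def jdet_def power2_eq_square)

lemma jconj_quad_rep:
  "jconj (quad_rep x y) = (2 * inner x y) *\<^sub>R jconj x - jdet x *\<^sub>R y"
  by (cases x; cases y) (simp add: quad_rep_eq jconj_def algebra_simps)

lemma jdet_quad_rep: "jdet (quad_rep x y) = (jdet x)\<^sup>2 * jdet y"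
proof -
  have "jdet (quad_rep x y) = 
    inner ((2 * inner x y) *\<^sub>R x - jdet x *\<^sub>R jconj y) ((2 * inner x y) *\<^sub>R jconj x - jdet x *\<^sub>R y)"
    by (simp add: inner_jconj_self[of "quad_rep x y", symmetric] jconj_quad_rep) (simp add: quad_rep_eq)
  also have "\<dots> = (jdet x)\<^sup>2 * jdet y"
    using inner_jconj_self[of x] inner_jconj_self[of y] inner_jconj_jconj[of x y]
    by (simp add: inner_simps inner_commute power2_eq_square algebra_simps)
  finally show ?thesis .
qed

text \<open>This is the self-adjointness of the quadratic representation, tested against the unit.\<close>

lemma fst_quad_rep: "fst (quad_rep x y) = inner (x \<bullet>\<^sub>J x) y"
  by (simp add: quad_rep_eq jordan_square_eq jconj_def junit_def inner_diff_left inner_prod_def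
      algebra_simps)

lemma quad_rep_jordan_inv:
  assumes "jdet x \<noteq> 0"
  shows "quad_rep x (quad_rep (jordan_inv x) y) = y"
proof -
  have conj: "quad_rep x (quad_rep (jconj x) y) = (jdet x)\<^sup>2 *\<^sub>R y"
  proof -
    have cc: "jconj (jconj z) = z" for z :: "'a spin" by (simp add: jconj_def)
    have inn: "inner x (quad_rep (jconj x) y) = jdet x * inner (jconj x) y"
      using inner_jconj_jconj[of "jconj x" y]
      by (simp add: quad_rep_eq inner_diff_right inner_jconj_self cc)
    show ?thesis
      by (simp add: quad_rep_eq[of x] inn jconj_quad_rep cc power2_eq_square algebra_simps)
  qed
  have "quad_rep (jordan_inv x) y = (1 / (jdet x)\<^sup>2) *\<^sub>R quad_rep (jconj x) y"
    by (simp add: jordan_inv_eq quad_rep_eq[of "c *\<^sub>R z" for c z] jdet_scaleR)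
      (simp add: quad_rep_eq power2_eq_square algebra_simps)
  then show ?thesis
    using assms by (simp add: quad_rep_scaleR conj)
qed

section \<open>Positivity on the Lorentz cone\<close>

lemma inner_pos_of_cone:
  assumes "x \<in> lorentz_cone" "y \<in> lorentz_cone"
  shows "inner x y > 0"
proof -
  obtain l u m v where x: "x = (l, u)" and y: "y = (m, v)" by (cases x, cases y)
  have "norm u < l" "norm v < m" using assms by (auto simp: x y lorentz_cone_def)
  then have "norm u * norm v < l * m" by (intro mult_strict_mono') auto
  moreover have "\<bar>inner u v\<bar> \<le> norm u * norm v" by (rule Cauchy_Schwarz_ineq2)
  ultimately show ?thesis by (simp add: x y)
qed

lemma square_in_cone: "x \<in> lorentz_cone \<Longrightarrow> x \<bullet>\<^sub>J x \<in> lorentz_cone"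
  unfolding lorentz_cone_iff jdet_square by (simp add: jordan_prod_def add_pos_nonneg)

text \<open>
  The sign of \<open>jdet\<close> alone would also admit minus the cone. That \<open>P x y\<close> lies in the right half
  is seen from its first component, an inner product of the two cone elements \<open>x \<bullet>\<^sub>J x\<close> and \<open>y\<close>.
\<close>

lemma quad_rep_in_cone:
  assumes "x \<in> lorentz_cone" "y \<in> lorentz_cone"
  shows "quad_rep x y \<in> lorentz_cone"
  using assms inner_pos_of_cone[OF square_in_cone[OF assms(1)] assms(2)]
  by (simp add: lorentz_cone_iff jdet_quad_rep fst_quad_rep)

section \<open>The square root in the cone\<close>

text \<open>
  If \<open>y \<bullet>\<^sub>J y = x\<close>, then \<open>jdet y = sqrt (jdet x)\<close> because the determinant is multiplicative on
  squares and positive on the cone, so the Cayley--Hamilton identity of \<open>y\<close> reads \<open>2 (fst y) y = x + sqrt (jdet x) e\<close>.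
  Its first component determines \<open>fst y\<close>, and then it determines \<open>y\<close>.
\<close>

lemma jordan_sqrt_unique:
  assumes y: "y \<in> lorentz_cone" and sq: "y \<bullet>\<^sub>J y = x"
  shows "y = (1 / sqrt (2 * (fst x + sqrt (jdet x)))) *\<^sub>R (x + sqrt (jdet x) *\<^sub>R junit)"
proof -
  have pos: "fst y > 0" "jdet y > 0" using y by (auto simp: lorentz_cone_iff)
  have d: "sqrt (jdet x) = jdet y"
    using jdet_square[of y] pos by (simp add: sq)
  have ch: "x + jdet y *\<^sub>R junit = (2 * fst y) *\<^sub>R y"
    using jordan_square_eq[of y] by (simp add: sq)
  have "fst x + jdet y = 2 * fst y * fst y"
    using arg_cong[OF ch, of fst] by (simp add: junit_def)
  then have "sqrt (2 * (fst x + jdet y)) = sqrt ((2 * fst y)\<^sup>2)"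
    by (simp add: power2_eq_square algebra_simps)
  then have "sqrt (2 * (fst x + jdet y)) = 2 * fst y"
    using pos by (simp only: real_sqrt_abs)
  then show ?thesis using pos by (simp add: d ch)
qed

lemma jordan_sqrt_exists:
  assumes x: "x \<in> lorentz_cone"
  defines "y \<equiv> (1 / sqrt (2 * (fst x + sqrt (jdet x)))) *\<^sub>R (x + sqrt (jdet x) *\<^sub>R junit)"
  shows "y \<in> lorentz_cone" "y \<bullet>\<^sub>J y = x" "jdet y = sqrt (jdet x)"
proof -
  define d where "d = sqrt (jdet x)"
  define N where "N = sqrt (2 * (fst x + d))"
  have pos: "fst x > 0" "jdet x > 0" using x by (auto simp: lorentz_cone_iff)
  have d: "d > 0" "d\<^sup>2 = jdet x" using pos by (auto simp: d_def)
  have N: "N > 0" "N\<^sup>2 = 2 * (fst x + d)" using pos d by (auto simp: N_def)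
  have y: "y = (1 / N) *\<^sub>R (x + d *\<^sub>R junit)" by (simp add: y_def N_def d_def)
  have "jdet (x + d *\<^sub>R junit) = N\<^sup>2 * d"
    unfolding jdet_add_junit N d(2)[symmetric] by (simp add: power2_eq_square algebra_simps)
  then have dy: "jdet y = d"
    using N(1) by (simp add: y jdet_scaleR power_divide)
  have fy: "fst y = N / 2"
    using N by (simp add: y junit_def power2_eq_square field_simps)
  show "y \<in> lorentz_cone" using fy dy N d by (simp add: lorentz_cone_iff)
  show "y \<bullet>\<^sub>J y = x"
    using N(1) by (simp add: jordan_square_eq fy dy) (simp add: y)
  show "jdet y = sqrt (jdet x)" using dy by (simp add: d_def)
qed

lemma jordan_sqrt_eq:
  assumes "x \<in> lorentz_cone"
  shows "jordan_sqrt x = (1 / sqrt (2 * (fst x + sqrt (jdet x)))) *\<^sub>R (x + sqrt (jdet x) *\<^sub>R junit)"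
  unfolding jordan_sqrt_def
  using jordan_sqrt_exists(1,2)[OF assms] jordan_sqrt_unique by (intro the_equality) blast+

lemma jordan_sqrt:
  assumes "x \<in> lorentz_cone"
  shows "jordan_sqrt x \<in> lorentz_cone" "jordan_sqrt x \<bullet>\<^sub>J jordan_sqrt x = x"
    "jdet (jordan_sqrt x) = sqrt (jdet x)"
  using jordan_sqrt_exists[OF assms] by (simp_all add: jordan_sqrt_eq[OF assms])

section \<open>The two geometric means\<close>

text \<open>
  With \<open>s\<close> the square root of \<open>p\<close>, the map \<open>P s\<close> is linear and carries \<open>h = P (s\<^sup>-\<^sup>1) q\<close> and the
  unit to \<open>q\<close> and \<open>p\<close>; so it carries the square root of \<open>h\<close>, a combination of \<open>h\<close> and the unit,
  to the same combination of \<open>q\<close> and \<open>p\<close>. Only the two coefficients remain to be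
  computed: \<open>jdet h = jdet q / jdet p\<close>, and \<open>fst h\<close> is the inner product of
  \<open>s\<^sup>-\<^sup>1 \<bullet>\<^sub>J s\<^sup>-\<^sup>1 = p\<^sup>-\<^sup>1\<close> with \<open>q\<close>.
\<close>

lemma metric_gmean_eq:
  assumes p: "p \<in> lorentz_cone" and q: "q \<in> lorentz_cone"
  defines "t \<equiv> sqrt (jdet q / jdet p)"
  shows "p \<sharp> q = (1 / sqrt (2 * (inner (jordan_inv p) q + t))) *\<^sub>R (q + t *\<^sub>R p)"
proof -
  define s where "s = jordan_sqrt p"
  define h where "h = quad_rep (jordan_inv s) q"
  have s: "s \<in> lorentz_cone" "s \<bullet>\<^sub>J s = p" "jdet s = sqrt (jdet p)"
    using jordan_sqrt[OF p] by (auto simp: s_def)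
  have pos: "jdet p > 0" "jdet s > 0" using p s(1) by (auto simp: lorentz_cone_iff)
  have h: "h \<in> lorentz_cone"
    unfolding h_def by (intro quad_rep_in_cone jordan_inv_in_cone s q)
  have "jdet h = jdet q / jdet p"
    using pos by (simp add: h_def jdet_quad_rep jdet_jordan_inv s power_divide)
  then have dh: "sqrt (jdet h) = t" by (simp add: t_def)
  have "jordan_inv s \<bullet>\<^sub>J jordan_inv s = (1 / (jdet s)\<^sup>2) *\<^sub>R jconj (s \<bullet>\<^sub>J s)"
    by (simp add: jordan_inv_eq jconj_def jordan_prod_def power2_eq_square add_divide_distrib
        scaleR_add_right)
  also have "\<dots> = jordan_inv p"
    using pos by (simp add: s jordan_inv_eq)
  finally have fh: "fst h = inner (jordan_inv p) q"
    by (simp add: h_def fst_quad_rep)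
  have sh: "quad_rep s h = q"
    using pos by (simp add: h_def quad_rep_jordan_inv)
  have "p \<sharp> q = quad_rep s (jordan_sqrt h)"
    by (simp add: metric_gmean_def s_def h_def)
  also have "\<dots> = (1 / sqrt (2 * (fst h + t))) *\<^sub>R (quad_rep s h + t *\<^sub>R quad_rep s junit)"
    by (simp only: jordan_sqrt_eq[OF h] dh quad_rep_scaleR quad_rep_add)
  finally show ?thesis by (simp add: sh fh quad_rep_junit s(2))
qed

lemma metric_gmean_in_cone:
  assumes "p \<in> lorentz_cone" and "q \<in> lorentz_cone"
  shows "p \<sharp> q \<in> lorentz_cone"
  unfolding metric_gmean_def
  by (intro quad_rep_in_cone jordan_sqrt jordan_inv_in_cone assms)

lemma jdet_metric_gmean:
  assumes p: "p \<in> lorentz_cone" and q: "q \<in> lorentz_cone"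
  shows "jdet (p \<sharp> q) = sqrt (jdet p * jdet q)"
proof -
  define h where "h = quad_rep (jordan_inv (jordan_sqrt p)) q"
  have pos: "jdet p > 0" using p by (auto simp: lorentz_cone_iff)
  have h: "h \<in> lorentz_cone"
    unfolding h_def by (intro quad_rep_in_cone jordan_inv_in_cone jordan_sqrt p q)
  have "jdet h = jdet q / jdet p"
    using pos by (simp add: h_def jdet_quad_rep jdet_jordan_inv jordan_sqrt[OF p] power_divide)
  then have "jdet (p \<sharp> q) = jdet p * sqrt (jdet q / jdet p)"
    using pos by (simp add: metric_gmean_def jdet_quad_rep jordan_sqrt[OF p] jordan_sqrt[OF h]
        flip: h_def)
  also have "\<dots> = sqrt (jdet p * jdet q)"
    using pos by (simp add: real_sqrt_divide real_sqrt_mult real_div_sqrt field_simps)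
  finally show ?thesis .
qed

text \<open>
  The factor \<open>1 / N\<close> of the square root \<open>w = (g + \<delta> e) / N\<close> enters \<open>P w x\<close> only through \<open>N\<^sup>2\<close>,
  which is rational in \<open>fst g\<close> and \<open>\<delta>\<close>.
\<close>

lemma quad_rep_jordan_sqrt:
  assumes g: "g \<in> lorentz_cone"
  defines "\<delta> \<equiv> sqrt (jdet g)"
  shows "quad_rep (jordan_sqrt g) x =
    ((inner g x + \<delta> * fst x) / (fst g + \<delta>)) *\<^sub>R (g + \<delta> *\<^sub>R junit) - \<delta> *\<^sub>R jconj x"
proof -
  define N where "N = sqrt (2 * (fst g + \<delta>))"
  have "fst g > 0" "\<delta> > 0" using g by (auto simp: lorentz_cone_iff \<delta>_def)
  then have N: "N * N = 2 * (fst g + \<delta>)" by (simp add: N_def)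
  have w: "jordan_sqrt g = (1 / N) *\<^sub>R (g + \<delta> *\<^sub>R junit)"
    by (simp add: jordan_sqrt_eq[OF g] N_def \<delta>_def)
  have i: "inner (jordan_sqrt g) x = (inner g x + \<delta> * fst x) / N"
    by (simp add: w inner_add_left junit_def inner_prod_def add_divide_distrib distrib_right)
  have "(2 * inner (jordan_sqrt g) x) *\<^sub>R jordan_sqrt g =
    (2 * (inner g x + \<delta> * fst x) / (N * N)) *\<^sub>R (g + \<delta> *\<^sub>R junit)"
    by (simp only: i) (simp add: w)
  also have "2 * (inner g x + \<delta> * fst x) / (N * N) = (inner g x + \<delta> * fst x) / (fst g + \<delta>)"
    unfolding N by (rule mult_divide_mult_cancel_left) simp
  finally show ?thesis
    by (simp add: quad_rep_eq jordan_sqrt(3)[OF g] flip: \<delta>_def)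
qed

theorem proposition9p4:
  fixes l \<mu> a b \<gamma> :: real and u v :: "real ^ 'm" and x y :: "'m spin"
  assumes "x = (l, u)" and "y = (\<mu>, v)"
    and "x \<in> lorentz_cone" and "y \<in> lorentz_cone"
    and "a = l\<^sup>2 - (norm u)\<^sup>2"
    and "b = \<mu>\<^sup>2 - (norm v)\<^sup>2"
    and "\<gamma> = sqrt ((l * \<mu> + inner u v + sqrt (a * b)) / 2)"
  shows "x \<natural> y =
    (\<gamma>, (1 / (l * sqrt b + \<mu> * sqrt a + 2 * \<gamma> * (a * b) powr (1 / 4))) *\<^sub>R
        ((a * b) powr (1 / 4) *\<^sub>R (\<mu> *\<^sub>R u + l *\<^sub>R v)
          + \<gamma> *\<^sub>R (sqrt b *\<^sub>R u + sqrt a *\<^sub>R v)))"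
proof -
  have xl: "fst x = l" "snd x = u" by (simp_all add: assms(1))
  have da: "jdet x = a" and db: "jdet y = b"
    using assms by (simp_all add: jdet_def power2_norm_eq_inner)
  have pos: "l > 0" "\<mu> > 0" "a > 0" "b > 0"
    using assms(1-4) da db by (auto simp: lorentz_cone_iff)
  have inn: "l * \<mu> + inner u v = inner x y" by (simp add: assms)
  have innpos: "inner x y > 0" by (rule inner_pos_of_cone[OF assms(3,4)])
  have \<gamma>pos: "\<gamma> > 0" and \<gamma>2: "\<gamma>\<^sup>2 = (inner x y + sqrt (a * b)) / 2"
    using innpos pos by (simp_all add: assms(7) inn add_pos_pos)

  define g where "g = jordan_inv x \<sharp> y"
  define \<delta> where "\<delta> = sqrt (jdet g)"
  have xi: "jordan_inv x \<in> lorentz_cone" by (rule jordan_inv_in_cone[OF assms(3)])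
  have g: "g \<in> lorentz_cone"
    unfolding g_def by (rule metric_gmean_in_cone[OF xi assms(4)])
  have dg: "jdet g = sqrt b / sqrt a"
    by (simp add: g_def jdet_metric_gmean[OF xi assms(4)] jdet_jordan_inv da db real_sqrt_divide)
  have \<delta>pos: "\<delta> > 0" and \<delta>2: "\<delta>\<^sup>2 = sqrt b / sqrt a"
    using pos by (simp_all add: \<delta>_def dg)
  have a\<delta>2: "sqrt a * \<delta>\<^sup>2 = sqrt b" using pos by (simp add: \<delta>2)
  have q4: "(a * b) powr (1 / 4) = sqrt a * \<delta>"
  proof -
    have "((sqrt a * \<delta>)\<^sup>2)\<^sup>2 = a * b"
      using pos by (simp add: power_mult_distrib \<delta>2 power_divide) (simp add: power2_eq_square)
    then have "(a * b) powr (1 / 4) = ((sqrt a * \<delta>) ^ 4) powr (1 / 4)"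
      by (simp flip: power_mult)
    also have "(sqrt a * \<delta>) ^ 4 = (sqrt a * \<delta>) powr 4"
      using pos \<delta>pos by simp
    also have "\<dots> powr (1 / 4) = sqrt a * \<delta>"
      using pos \<delta>pos by (simp only: powr_powr) simp
    finally show ?thesis .
  qed

  have t: "sqrt (jdet y / jdet (jordan_inv x)) = sqrt (a * b)"
    by (simp add: jdet_jordan_inv da db mult.commute)
  have ii: "jordan_inv (jordan_inv x) = x"
    using pos(3) by (simp add: jordan_inv_eq jdet_scaleR da power2_eq_square)
      (simp add: jconj_def)
  have "sqrt (2 * (inner x y + sqrt (a * b))) = sqrt ((2 * \<gamma>)\<^sup>2)"
    by (simp add: \<gamma>2 power_mult_distrib)
  then have "sqrt (2 * (inner x y + sqrt (a * b))) = 2 * \<gamma>"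
    using \<gamma>pos by (simp only: real_sqrt_abs)
  then have g0: "g = (1 / (2 * \<gamma>)) *\<^sub>R (y + sqrt (a * b) *\<^sub>R jordan_inv x)"
    by (simp add: g_def metric_gmean_eq[OF xi assms(4)] t ii)
  have "sqrt (a * b) / a = \<delta>\<^sup>2"
    using pos by (simp add: \<delta>2 real_sqrt_mult frac_eq_eq)
  then have g1: "g = (1 / (2 * \<gamma>)) *\<^sub>R (y + \<delta>\<^sup>2 *\<^sub>R jconj x)"
    by (simp add: g0 jordan_inv_eq da)
  have "inner g x = (inner x y + \<delta>\<^sup>2 * a) / (2 * \<gamma>)"
    using inner_jconj_self[of x] by (simp add: g1 inner_simps inner_commute da)
  also have "\<delta>\<^sup>2 * a = sqrt (a * b)"
    using pos by (simp flip: \<open>sqrt (a * b) / a = \<delta>\<^sup>2\<close>)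
  also have "(inner x y + sqrt (a * b)) / (2 * \<gamma>) = \<gamma>"
    using \<gamma>2 \<gamma>pos by (simp add: field_simps power2_eq_square)
  finally have gx: "inner g x = \<gamma>" .

  define D where "D = \<mu> + \<delta>\<^sup>2 * l + 2 * \<gamma> * \<delta>"
  have Dpos: "D > 0" using pos \<gamma>pos \<delta>pos by (simp add: D_def add_pos_pos)
  have fg: "fst g + \<delta> = D / (2 * \<gamma>)"
    using \<gamma>pos by (simp add: g1 jconj_def assms(1,2) D_def field_simps)
  have sg: "snd g = (1 / (2 * \<gamma>)) *\<^sub>R (v - \<delta>\<^sup>2 *\<^sub>R u)"
    by (simp add: g1 jconj_def assms(1,2))
  have P: "x \<natural> y = ((\<gamma> + \<delta> * l) / (fst g + \<delta>)) *\<^sub>R (g + \<delta> *\<^sub>R junit) - \<delta> *\<^sub>R jconj x"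
    using quad_rep_jordan_sqrt[OF g, of x]
    by (simp add: spectral_gmean_def gx xl flip: g_def \<delta>_def)
  have "fst g + \<delta> \<noteq> 0" using fg Dpos \<gamma>pos by simp
  then have 1: "fst (x \<natural> y) = \<gamma>"
    by (simp add: P junit_def jconj_def xl)
  have "snd (x \<natural> y) = ((\<gamma> + \<delta> * l) / D) *\<^sub>R (v - \<delta>\<^sup>2 *\<^sub>R u) + \<delta> *\<^sub>R u"
    using \<gamma>pos by (simp add: P junit_def jconj_def fg sg xl)
  also have "\<dots> = (1 / D) *\<^sub>R ((\<gamma> + \<delta> * l) *\<^sub>R (v - \<delta>\<^sup>2 *\<^sub>R u) + (D * \<delta>) *\<^sub>R u)"
    using Dpos by (simp add: scaleR_add_right)
  also have "(\<gamma> + \<delta> * l) *\<^sub>R (v - \<delta>\<^sup>2 *\<^sub>R u) + (D * \<delta>) *\<^sub>R u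
      = \<delta> *\<^sub>R (\<mu> *\<^sub>R u + l *\<^sub>R v) + \<gamma> *\<^sub>R (\<delta>\<^sup>2 *\<^sub>R u + v)"
    by (simp add: D_def vec_eq_iff power2_eq_square algebra_simps)
  finally have 2: "snd (x \<natural> y) = (1 / D) *\<^sub>R \<dots>" .
  have "l * sqrt b + \<mu> * sqrt a + 2 * \<gamma> * (a * b) powr (1 / 4) = sqrt a * D"
    by (simp add: q4 D_def algebra_simps flip: a\<delta>2)
  moreover have "(a * b) powr (1 / 4) *\<^sub>R (\<mu> *\<^sub>R u + l *\<^sub>R v) + \<gamma> *\<^sub>R (sqrt b *\<^sub>R u + sqrt a *\<^sub>R v)
      = sqrt a *\<^sub>R (\<delta> *\<^sub>R (\<mu> *\<^sub>R u + l *\<^sub>R v) + \<gamma> *\<^sub>R (\<delta>\<^sup>2 *\<^sub>R u + v))"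
    by (simp add: q4 algebra_simps flip: a\<delta>2)
  ultimately show ?thesis
    using pos 1 2 by (simp add: prod_eq_iff)
qed

end
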